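(* Let $(H;\langle\cdot,\cdot\rangle)$ be an inner product space over the real or complex number field $\mathbb{K}$, let $n\ge2$ be an integer, let $x_i\in H$ for $i\in\{1,\dots,n\}$, and let $p>1$ and $q$ be real numbers with $\frac1p+\frac1q=1$. Then $$\Big(\sum_{i=1}^n\|x_i\|\Big)^2\le\Big\|\sum_{i=1}^n x_i\Big\|^2+\sum_{1\le i<j\le n}(j-i)^{2/q}\Big(\sum_{k=1}^{n-1}\|\Delta x_k\|^p\Big)^{2/p}.$$ The constant $1$ in front of the double sum cannot in general be replaced by a smaller constant: if $H\ne\{0\}$ and $E>0$ is a constant such that $$\Big(\sum_{i=1}^n\|x_i\|\Big)^2\le\Big\|\sum_{i=1}^n x_i\Big\|^2+E\sum_{1\le i<j\le n}(j-i)^{2/q}\Big(\sum_{k=1}^{n-1}\|\Delta x_k\|^p\Big)^{2/p}$$ for all $n\ge2$ and all $x_1,\dots,x_n\in H$, then $E\ge1$.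
   Context: $\|\cdot\|$ is the norm induced by the inner product, and $\Delta x_k:=x_{k+1}-x_k$ for $1\le k\le n-1$ denotes the forward difference. *)

theory Defs
  imports "HOL-Analysis.Inner_Product"
begin

text \<open>
  The scalar field is (a copy of) the reals or the complex numbers. The map \<open>to_complex\<close> is
  the inclusion into the complex numbers; being a field homomorphism, it is injective.
\<close>

class real_or_complex = field +
  fixes to_complex :: "'a \<Rightarrow> complex"
  assumes to_complex_add: "to_complex (a + b) = to_complex a + to_complex b"
    and to_complex_mult: "to_complex (a * b) = to_complex a * to_complex b"
    and to_complex_one: "to_complex 1 = 1"
    and range_to_complex: "range to_complex = \<real> \<or> range to_complex = UNIV"

instantiation real :: real_or_complex
begin

definition to_complex_real :: "real \<Rightarrow> complex" where
  "to_complex_real = complex_of_real"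

instance
  by standard (auto simp: to_complex_real_def Reals_def)

end

instantiation complex :: real_or_complex
begin

definition to_complex_complex :: "complex \<Rightarrow> complex" where
  "to_complex_complex = id"

instance
  by standard (auto simp: to_complex_complex_def)

end

text \<open>
  Inner products are linear in the first argument. That \<open>ip x x\<close> is real follows from
  \<open>ip_commute\<close>.
\<close>

locale inner_product_space = vector_space scale
  for scale :: "'k::real_or_complex \<Rightarrow> 'h::ab_group_add \<Rightarrow> 'h" +
  fixes ip :: "'h \<Rightarrow> 'h \<Rightarrow> 'k"
  assumes ip_commute: "to_complex (ip y x) = cnj (to_complex (ip x y))"
    and ip_add_left: "ip (x + y) z = ip x z + ip y z"
    and ip_scale_left: "ip (scale a x) y = a * ip x y"
    and ip_ge_zero: "0 \<le> Re (to_complex (ip x x))"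
    and ip_eq_zero: "ip x x = 0 \<Longrightarrow> x = 0"

definition ip_norm :: "('h \<Rightarrow> 'h \<Rightarrow> 'k::real_or_complex) \<Rightarrow> 'h \<Rightarrow> real" where
  "ip_norm ip x = sqrt (Re (to_complex (ip x x)))"

definition fdiff :: "(nat \<Rightarrow> 'h::ab_group_add) \<Rightarrow> nat \<Rightarrow> 'h" where
  "fdiff x k = x (k + 1) - x k"

lemma real_inner_inner_product_space:
  "inner_product_space (scaleR :: real \<Rightarrow> 'a::real_inner \<Rightarrow> 'a) inner"
  by unfold_locales
    (auto simp: to_complex_real_def inner_commute inner_add_left algebra_simps)

lemma ip_norm_inner: "ip_norm inner (x :: 'a::real_inner) = norm x"
  by (simp add: ip_norm_def to_complex_real_def norm_eq_sqrt_inner)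

lemma complex_inner_product_space:
  "inner_product_space ((*) :: complex \<Rightarrow> complex \<Rightarrow> complex) (\<lambda>z w. z * cnj w)"
  by unfold_locales (auto simp: to_complex_complex_def algebra_simps)

lemma ip_norm_complex: "ip_norm (\<lambda>z w. z * cnj w) z = cmod z"
  by (simp add: ip_norm_def to_complex_complex_def cmod_def power2_eq_square)

end

theory Submission
  imports Defs "HOL-Analysis.Convex"
begin

text \<open>
  Expanding both squares,
  \[ \Big(\sum_i \|x_i\|\Big)^2 - \Big\|\sum_i x_i\Big\|^2
     = \sum_{i<j} 2\,\big(\|x_i\|\,\|x_j\| - \mathrm{Re}\,\langle x_i,x_j\rangle\big), \]
  and each term on the right is at most \<open>\<parallel>x\<^sub>j - x\<^sub>i\<parallel>\<^sup>2\<close>, the difference being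
  \<open>(\<parallel>x\<^sub>i\<parallel> - \<parallel>x\<^sub>j\<parallel>)\<^sup>2\<close>. This is \<open>sum_ip_norm_power2_le\<close>. It remains to bound the distance
  between two members of the sequence: \<open>x\<^sub>j - x\<^sub>i\<close> telescopes into the \<open>j - i\<close> consecutive
  differences between them, so the triangle inequality and Hoelder's inequality against the
  constant sequence 1 give
  \<open>\<parallel>x\<^sub>j - x\<^sub>i\<parallel> \<le> (j - i)\<^bsup>1/q\<^esup> (\<Sum>\<^sub>k \<parallel>\<Delta>x\<^sub>k\<parallel>\<^sup>p)\<^bsup>1/p\<^esup>\<close>.

  The constant 1 is attained for \<open>n = 2\<close> by a pair of opposite vectors \<open>e, -e\<close>, for which the
  sum vanishes and both sides equal \<open>4 \<parallel>e\<parallel>\<^sup>2\<close>.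

  Only the real bilinear form \<open>Re \<langle>x, y\<rangle>\<close> enters, so the two scalar fields are treated at once;
  the real numbers inside the field supply the scalars for the Cauchy--Schwarz inequality.
\<close>

section \<open>The real part of the inner product\<close>

lemma to_complex_zero [simp]: "to_complex (0 :: 'k::real_or_complex) = 0"
  using to_complex_add[of "0 :: 'k" 0] by simp

lemma to_complex_eq_0D:
  fixes a :: "'k::real_or_complex"
  assumes "to_complex a = 0"
  shows "a = 0"
proof (rule ccontr)
  assume "a \<noteq> 0"
  then have "to_complex (a * inverse a) = 1"
    by (simp add: to_complex_one)
  then show False
    using assms by (simp add: to_complex_mult)
qed

lemma ex_to_complex_of_real: "\<exists>a :: 'k::real_or_complex. to_complex a = of_real r"
proof -
  have "complex_of_real r \<in> range (to_complex :: 'k \<Rightarrow> complex)"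
    using range_to_complex[where 'a='k] by auto
  then show ?thesis
    by (auto simp: image_iff eq_commute)
qed

context inner_product_space
begin

definition re_ip :: "'h \<Rightarrow> 'h \<Rightarrow> real" where
  "re_ip x y = Re (to_complex (ip x y))"

lemma re_ip_commute: "re_ip x y = re_ip y x"
  by (simp add: re_ip_def ip_commute[of x y])

lemma re_ip_add_left: "re_ip (x + y) z = re_ip x z + re_ip y z"
  by (simp add: re_ip_def ip_add_left to_complex_add)

lemma re_ip_add_right: "re_ip x (y + z) = re_ip x y + re_ip x z"
  using re_ip_add_left re_ip_commute by metis

lemma re_ip_zero_left [simp]: "re_ip 0 x = 0"
  using re_ip_add_left[of 0 0 x] by simp

lemma re_ip_zero_right [simp]: "re_ip x 0 = 0"
  using re_ip_commute[of x 0] by simp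

lemma re_ip_minus_left: "re_ip (- x) y = - re_ip x y"
  using re_ip_add_left[of x "- x" y] by simp

lemma re_ip_minus_right: "re_ip x (- y) = - re_ip x y"
  using re_ip_minus_left re_ip_commute by metis

lemma re_ip_diff_left: "re_ip (x - y) z = re_ip x z - re_ip y z"
  using re_ip_add_left[of x "- y" z] by (simp add: re_ip_minus_left)

lemma re_ip_diff_right: "re_ip x (y - z) = re_ip x y - re_ip x z"
  using re_ip_diff_left re_ip_commute by metis

lemma re_ip_sum_left: "re_ip (\<Sum>i\<in>A. x i) y = (\<Sum>i\<in>A. re_ip (x i) y)"
  by (induction A rule: infinite_finite_induct) (simp_all add: re_ip_add_left)

lemma re_ip_scale_left:
  assumes "to_complex a = of_real r"
  shows "re_ip (scale a x) y = r * re_ip x y"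
  using assms by (simp add: re_ip_def ip_scale_left to_complex_mult)

lemma re_ip_scale_right:
  assumes "to_complex a = of_real r"
  shows "re_ip x (scale a y) = r * re_ip x y"
  using re_ip_scale_left[OF assms, of y x]
  by (simp add: re_ip_commute[of x "scale a y"] re_ip_commute[of x y])

lemma re_ip_self_nonneg: "0 \<le> re_ip x x"
  using ip_ge_zero by (simp add: re_ip_def)

lemma re_ip_self_eq_0D:
  assumes "re_ip x x = 0"
  shows "x = 0"
proof -
  have "Im (to_complex (ip x x)) = 0"
    using arg_cong[OF ip_commute[of x x], of Im] by simp
  then have "to_complex (ip x x) = 0"
    using assms by (simp add: re_ip_def complex_eq_iff)
  then show ?thesis
    by (rule ip_eq_zero[OF to_complex_eq_0D])
qed

lemma re_ip_Cauchy_Schwarz: "(re_ip x y)\<^sup>2 \<le> re_ip x x * re_ip y y"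
proof (cases "y = 0")
  case False
  then have pos: "re_ip y y > 0"
    using re_ip_self_nonneg[of y] re_ip_self_eq_0D[of y] by (auto simp: less_le)
  obtain s :: 'k where s: "to_complex s = of_real (re_ip y y)"
    using ex_to_complex_of_real by blast
  obtain t :: 'k where t: "to_complex t = of_real (re_ip x y)"
    using ex_to_complex_of_real by blast
  note scale = re_ip_scale_left[OF s] re_ip_scale_left[OF t]
    re_ip_scale_right[OF s] re_ip_scale_right[OF t]
  \<comment> \<open>Up to the factor \<open>\<langle>y, y\<rangle>\<close>, which avoids a division, this is the component of \<open>x\<close>
      orthogonal to \<open>y\<close>.\<close>
  have "0 \<le> re_ip (scale s x - scale t y) (scale s x - scale t y)"
    by (rule re_ip_self_nonneg)
  also have "\<dots> = re_ip y y * (re_ip x x * re_ip y y - (re_ip x y)\<^sup>2)"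
    by (simp add: re_ip_diff_left re_ip_diff_right scale
        re_ip_commute[of y x] power2_eq_square algebra_simps)
  finally show ?thesis
    using pos by (simp add: zero_le_mult_iff)
qed simp

section \<open>The norm\<close>

lemma ip_norm_nonneg: "0 \<le> ip_norm ip x"
  by (simp add: ip_norm_def ip_ge_zero)

lemma ip_norm_power2: "(ip_norm ip x)\<^sup>2 = re_ip x x"
  by (simp add: ip_norm_def re_ip_def ip_ge_zero)

lemma ip_norm_zero [simp]: "ip_norm ip 0 = 0"
  using ip_norm_power2[of 0] by simp

lemma ip_norm_pos: "x \<noteq> 0 \<Longrightarrow> 0 < ip_norm ip x"
  using ip_norm_nonneg[of x] ip_norm_power2[of x] re_ip_self_eq_0D[of x]
  by (auto simp: less_le)

lemma re_ip_le_ip_norm: "re_ip x y \<le> ip_norm ip x * ip_norm ip y"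
  by (rule power2_le_imp_le)
    (simp_all add: power_mult_distrib ip_norm_power2 ip_norm_nonneg re_ip_Cauchy_Schwarz)

lemma ip_norm_add_le: "ip_norm ip (x + y) \<le> ip_norm ip x + ip_norm ip y"
proof (rule power2_le_imp_le)
  have "(ip_norm ip (x + y))\<^sup>2 = re_ip x x + 2 * re_ip x y + re_ip y y"
    by (simp add: ip_norm_power2 re_ip_add_left re_ip_add_right re_ip_commute[of y x])
  also have "\<dots> \<le> (ip_norm ip x + ip_norm ip y)\<^sup>2"
    using re_ip_le_ip_norm[of x y] by (simp add: power2_sum ip_norm_power2)
  finally show "(ip_norm ip (x + y))\<^sup>2 \<le> (ip_norm ip x + ip_norm ip y)\<^sup>2" .
qed (simp add: ip_norm_nonneg)

lemma ip_norm_sum_le: "ip_norm ip (\<Sum>i\<in>A. x i) \<le> (\<Sum>i\<in>A. ip_norm ip (x i))"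
proof (induction A rule: infinite_finite_induct)
  case (insert a A)
  then show ?case
    using ip_norm_add_le[of "x a" "\<Sum>i\<in>A. x i"] by simp
qed simp_all

text \<open>
  The gap is \<open>(\<parallel>x\<parallel> - \<parallel>y\<parallel>)\<^sup>2\<close>, because
  \<open>\<parallel>y - x\<parallel>\<^sup>2 = \<parallel>x\<parallel>\<^sup>2 + \<parallel>y\<parallel>\<^sup>2 - 2 Re \<langle>x, y\<rangle>\<close>.
\<close>

lemma Cauchy_Schwarz_gap_le:
  "2 * (ip_norm ip x * ip_norm ip y - re_ip x y) \<le> (ip_norm ip (y - x))\<^sup>2"
proof -
  have "(ip_norm ip (y - x))\<^sup>2 = (ip_norm ip x)\<^sup>2 + (ip_norm ip y)\<^sup>2 - 2 * re_ip x y"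
    by (simp add: ip_norm_power2 re_ip_diff_left re_ip_diff_right re_ip_commute[of y x])
  then show ?thesis
    using zero_le_power2[of "ip_norm ip x - ip_norm ip y"] by (simp add: power2_diff)
qed

end

section \<open>The reverse triangle inequality in terms of pairwise distances\<close>

lemma finite_index_pairs: "finite {(i, j). 1 \<le> i \<and> i < j \<and> j \<le> (n::nat)}"
  by (rule finite_subset[of _ "{1..n} \<times> {1..n}"]) auto

lemma index_pairs_Suc:
  "{(i, j). 1 \<le> i \<and> i < j \<and> j \<le> Suc n}
     = {(i, j). 1 \<le> i \<and> i < j \<and> j \<le> n} \<union> (\<lambda>i. (i, Suc n)) ` {1..n}"
  by (auto simp: le_Suc_eq)

context inner_product_space
begin

text \<open>
  Appending a vector \<open>y\<close> to the sequence increases the left-hand side by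
  \<open>\<Sum>\<^sub>i 2 \<parallel>x\<^sub>i\<parallel> \<parallel>y\<parallel> + \<parallel>y\<parallel>\<^sup>2\<close> and the squared norm of the sum by
  \<open>\<Sum>\<^sub>i 2 Re \<langle>x\<^sub>i, y\<rangle> + \<parallel>y\<parallel>\<^sup>2\<close>, so the new pairs have to pay for the gap in the Cauchy--Schwarz
  inequality between \<open>y\<close> and each \<open>x\<^sub>i\<close>.
\<close>

lemma sum_ip_norm_power2_le:
  fixes x :: "nat \<Rightarrow> 'h"
  shows "(\<Sum>i=1..n. ip_norm ip (x i))\<^sup>2
           \<le> (ip_norm ip (\<Sum>i=1..n. x i))\<^sup>2
             + (\<Sum>(i, j) \<in> {(i, j). 1 \<le> i \<and> i < j \<and> j \<le> n}. (ip_norm ip (x j - x i))\<^sup>2)"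
proof (induction n)
  case 0
  then show ?case by (auto intro: sum_nonneg)
next
  case (Suc n)
  let ?N = "ip_norm ip" and ?y = "x (Suc n)" and ?X = "\<Sum>i=1..n. x i"
  let ?P = "\<lambda>n. {(i, j). 1 \<le> i \<and> i < j \<and> j \<le> (n::nat)}"
  have pairs: "(\<Sum>(i, j) \<in> ?P (Suc n). (?N (x j - x i))\<^sup>2)
      = (\<Sum>(i, j) \<in> ?P n. (?N (x j - x i))\<^sup>2) + (\<Sum>i=1..n. (?N (?y - x i))\<^sup>2)"
  proof -
    have "(\<Sum>(i, j) \<in> ?P (Suc n). (?N (x j - x i))\<^sup>2)
        = (\<Sum>(i, j) \<in> ?P n. (?N (x j - x i))\<^sup>2)
          + (\<Sum>(i, j) \<in> (\<lambda>i. (i, Suc n)) ` {1..n}. (?N (x j - x i))\<^sup>2)"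
      unfolding index_pairs_Suc
      by (rule sum.union_disjoint) (use finite_index_pairs in auto)
    then show ?thesis
      by (simp add: sum.reindex inj_on_def)
  qed
  have "2 * ((\<Sum>i=1..n. ?N (x i)) * ?N ?y - re_ip ?X ?y)
      = (\<Sum>i=1..n. 2 * (?N (x i) * ?N ?y - re_ip (x i) ?y))"
    by (simp add: re_ip_sum_left sum_distrib_left sum_distrib_right sum_subtractf
        right_diff_distrib)
  also have "\<dots> \<le> (\<Sum>i=1..n. (?N (?y - x i))\<^sup>2)"
    by (intro sum_mono Cauchy_Schwarz_gap_le)
  finally have gap: "2 * ((\<Sum>i=1..n. ?N (x i)) * ?N ?y - re_ip ?X ?y)
      \<le> (\<Sum>i=1..n. (?N (?y - x i))\<^sup>2)" .
  have norm: "(?N (?X + ?y))\<^sup>2 = (?N ?X)\<^sup>2 + 2 * re_ip ?X ?y + (?N ?y)\<^sup>2"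
    using re_ip_commute[of ?y ?X]
    by (simp add: ip_norm_power2 re_ip_add_left re_ip_add_right)
  have "((\<Sum>i=1..n. ?N (x i)) + ?N ?y)\<^sup>2
      \<le> (?N (?X + ?y))\<^sup>2 + ((\<Sum>(i, j) \<in> ?P n. (?N (x j - x i))\<^sup>2)
         + (\<Sum>i=1..n. (?N (?y - x i))\<^sup>2))"
    unfolding norm using Suc.IH gap by (simp add: power2_sum algebra_simps)
  then show ?case
    unfolding pairs by simp
qed

end

section \<open>Distances bounded by the consecutive differences\<close>

text \<open>
  This is Hoelder's inequality against the constant sequence 1. With \<open>A = (\<Sum> a\<^sub>k\<^sup>p)\<^bsup>1/p\<^esup>\<close> and
  \<open>m\<close> the number of terms, Young's inequality applied to \<open>a\<^sub>k / A\<close> and \<open>m\<^bsup>-1/q\<^esup>\<close> bounds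
  the normalised product by \<open>(a\<^sub>k / A)\<^sup>p / p + (1/m) / q\<close>, and these bounds add up to
  \<open>1/p + 1/q = 1\<close>.
\<close>

lemma sum_le_card_powr_times_sum_powr:
  fixes a :: "'a \<Rightarrow> real" and p q :: real
  assumes "p > 1" "1 / p + 1 / q = 1" and nonneg: "\<And>k. k \<in> S \<Longrightarrow> 0 \<le> a k"
  shows "(\<Sum>k\<in>S. a k) \<le> card S powr (1 / q) * (\<Sum>k\<in>S. a k powr p) powr (1 / p)"
proof (cases "finite S \<and> (\<exists>k\<in>S. a k \<noteq> 0)")
  case False
  then have "(\<Sum>k\<in>S. a k) = 0"
    by (cases "finite S") auto
  then show ?thesis
    by simp
next
  case True
  then obtain l where fin: "finite S" and l: "l \<in> S" "a l \<noteq> 0"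
    by blast
  have "1 / p > 0" "1 / p < 1"
    using assms(1) by simp_all
  then have "1 / q > 0" "1 / q < 1"
    using assms(2) by linarith+
  then have q: "q > 1"
    by (simp add: divide_less_eq split: if_splits)
  define m where "m = real (card S)"
  have m: "m > 0"
    using fin l by (auto simp: m_def card_gt_0_iff)
  define T where "T = (\<Sum>k\<in>S. a k powr p)"
  have T: "T > 0"
    unfolding T_def using fin l by (intro sum_pos2[where i = l]) auto
  define A where "A = T powr (1 / p)"
  have A: "A > 0" "A powr p = T"
    using T assms(1) by (simp_all add: A_def powr_powr)
  define c where "c = m powr (- (1 / q))"
  have c: "c > 0" "c powr q = 1 / m" "1 / c = m powr (1 / q)"
    unfolding c_def powr_powr using m q by (simp_all add: powr_minus divide_simps)
  have "(\<Sum>k\<in>S. a k / A * c) \<le> (\<Sum>k\<in>S. (a k powr p / T) / p + (1 / m) / q)"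
  proof (rule sum_mono)
    fix k assume "k \<in> S"
    then show "a k / A * c \<le> (a k powr p / T) / p + (1 / m) / q"
      using Youngs_inequality[of p q "a k / A" c] assms(1,2) q A c nonneg[of k]
      by (simp add: powr_divide)
  qed
  also have "\<dots> = (\<Sum>k\<in>S. a k powr p) / T / p + m * (1 / m) / q"
    by (simp add: sum.distrib sum_divide_distrib m_def)
  also have "\<dots> = 1"
    using T m assms(2) by (simp add: T_def)
  finally have "(\<Sum>k\<in>S. a k) / A * c \<le> 1"
    by (simp add: sum_divide_distrib sum_distrib_right)
  then have "(\<Sum>k\<in>S. a k) \<le> (1 / c) * A"
    using A c by (simp add: field_simps)
  then show ?thesis
    using c by (simp add: A_def T_def m_def)
qed

context inner_product_space
begin

lemma ip_norm_diff_power2_le: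
  fixes x :: "nat \<Rightarrow> 'h" and p q :: real
  assumes "p > 1" "1 / p + 1 / q = 1" and ij: "1 \<le> i" "i < j" "j \<le> n"
  shows "(ip_norm ip (x j - x i))\<^sup>2
           \<le> (real j - real i) powr (2 / q)
             * (\<Sum>k=1..n-1. ip_norm ip (fdiff x k) powr p) powr (2 / p)"
proof -
  let ?d = "\<lambda>k. ip_norm ip (fdiff x k)"
  have square: "(u powr (1 / r))\<^sup>2 = u powr (2 / r)" for u r :: real
    by (simp add: power2_eq_square flip: powr_add)
  have "x j - x i = (\<Sum>k=i..<j. fdiff x k)"
    using ij sum_Suc_diff'[of i j x] by (simp add: fdiff_def)
  then have "ip_norm ip (x j - x i) \<le> (\<Sum>k=i..<j. ?d k)"
    using ip_norm_sum_le[of "fdiff x" "{i..<j}"] by simp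
  also have "\<dots> \<le> (real j - real i) powr (1 / q) * (\<Sum>k=i..<j. ?d k powr p) powr (1 / p)"
    using sum_le_card_powr_times_sum_powr[OF assms(1,2), of "{i..<j}" ?d] ij
    by (simp add: ip_norm_nonneg of_nat_diff)
  also have "\<dots> \<le> (real j - real i) powr (1 / q) * (\<Sum>k=1..n-1. ?d k powr p) powr (1 / p)"
    using assms(1) ij by (intro mult_left_mono powr_mono2 sum_mono2) (auto intro: sum_nonneg)
  finally have "(ip_norm ip (x j - x i))\<^sup>2
      \<le> ((real j - real i) powr (1 / q) * (\<Sum>k=1..n-1. ?d k powr p) powr (1 / p))\<^sup>2"
    by (intro power_mono ip_norm_nonneg)
  also have "\<dots> = (real j - real i) powr (2 / q) * (\<Sum>k=1..n-1. ?d k powr p) powr (2 / p)"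
    by (simp add: power_mult_distrib square)
  finally show ?thesis .
qed

section \<open>The extremal pair of opposite vectors\<close>

lemma opposite_pair_constant_ge_1:
  fixes x :: "nat \<Rightarrow> 'h" and e :: 'h and p q E :: real
  defines "x \<equiv> (\<lambda>i. if i = 1 then e else - e)"
  assumes "p > 1" "e \<noteq> 0"
    and le: "(\<Sum>i=1..2. ip_norm ip (x i))\<^sup>2
        \<le> (ip_norm ip (\<Sum>i=1..2. x i))\<^sup>2
          + E * (\<Sum>(i, j) \<in> {(i, j). 1 \<le> i \<and> i < j \<and> j \<le> 2}.
              (real j - real i) powr (2 / q)
              * (\<Sum>k=1..2-1. ip_norm ip (fdiff x k) powr p) powr (2 / p))"
  shows "E \<ge> 1"
proof -
  let ?N = "ip_norm ip"
  have x12: "x 1 = e" "x 2 = - e"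
    by (simp_all add: x_def)
  have two: "{1..2::nat} = {1, 2}"
    by auto
  have pairs: "{(i, j). 1 \<le> i \<and> i < j \<and> j \<le> (2::nat)} = {(1, 2)}"
    by auto
  have pos: "?N e > 0"
    using assms(3) by (rule ip_norm_pos)
  have minus: "?N (- e) = ?N e"
    by (rule power2_eq_imp_eq)
      (simp_all add: ip_norm_power2 re_ip_minus_left re_ip_minus_right ip_norm_nonneg)
  have diff: "(?N (- e - e))\<^sup>2 = 4 * (?N e)\<^sup>2"
    by (simp add: ip_norm_power2 re_ip_diff_left re_ip_diff_right re_ip_minus_left
        re_ip_minus_right)
  have fdiff: "fdiff x 1 = - e - e"
    using x12 by (simp add: fdiff_def numeral_2_eq_2)
  have powr: "(?N v powr p) powr (2 / p) = (?N v)\<^sup>2" for v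
    using assms(2) ip_norm_nonneg[of v] by (cases "?N v = 0") (simp_all add: powr_powr)
  have "(?N e + ?N e)\<^sup>2 \<le> E * (4 * (?N e)\<^sup>2)"
    using le by (simp add: two pairs x12 minus fdiff fdiff[unfolded One_nat_def] powr diff
        del: One_nat_def)
  then have "1 * (?N e)\<^sup>2 \<le> E * (?N e)\<^sup>2"
    by (simp add: power2_eq_square)
  then show ?thesis
    using pos by (metis mult_right_le_imp_le zero_less_power)
qed

end

section \<open>The inequality and its best constant\<close>

theorem proposition3:
  fixes scale :: "'k::real_or_complex \<Rightarrow> 'h::ab_group_add \<Rightarrow> 'h"
    and ip :: "'h \<Rightarrow> 'h \<Rightarrow> 'k"
    and p q :: real
  assumes "inner_product_space scale ip"
    and "p > 1"
    and "1 / p + 1 / q = 1"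
  shows "(\<forall>n\<ge>2. \<forall>x :: nat \<Rightarrow> 'h.
            (\<Sum>i=1..n. ip_norm ip (x i))\<^sup>2
              \<le> (ip_norm ip (\<Sum>i=1..n. x i))\<^sup>2
                + (\<Sum>(i, j) \<in> {(i, j). 1 \<le> i \<and> i < j \<and> j \<le> n}.
                    (real j - real i) powr (2 / q)
                    * (\<Sum>k=1..n-1. ip_norm ip (fdiff x k) powr p) powr (2 / p)))
       \<and> (\<forall>E>0. (UNIV :: 'h set) \<noteq> {0} \<longrightarrow>
            (\<forall>n\<ge>2. \<forall>x :: nat \<Rightarrow> 'h.
              (\<Sum>i=1..n. ip_norm ip (x i))\<^sup>2
                \<le> (ip_norm ip (\<Sum>i=1..n. x i))\<^sup>2
                  + E * (\<Sum>(i, j) \<in> {(i, j). 1 \<le> i \<and> i < j \<and> j \<le> n}.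
                      (real j - real i) powr (2 / q)
                      * (\<Sum>k=1..n-1. ip_norm ip (fdiff x k) powr p) powr (2 / p)))
            \<longrightarrow> E \<ge> 1)"
proof -
  interpret inner_product_space scale ip
    by (rule assms(1))
  note pq = assms(2,3)
  have upper: "(\<Sum>i=1..n. ip_norm ip (x i))\<^sup>2
      \<le> (ip_norm ip (\<Sum>i=1..n. x i))\<^sup>2
        + (\<Sum>(i, j) \<in> {(i, j). 1 \<le> i \<and> i < j \<and> j \<le> n}.
            (real j - real i) powr (2 / q)
            * (\<Sum>k=1..n-1. ip_norm ip (fdiff x k) powr p) powr (2 / p))"
    for n :: nat and x :: "nat \<Rightarrow> 'h"
    by (rule order_trans[OF sum_ip_norm_power2_le add_left_mono], rule sum_mono)
      (auto simp del: One_nat_def intro: ip_norm_diff_power2_le[OF pq])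
  have sharp: "E \<ge> 1"
    if nontrivial: "(UNIV :: 'h set) \<noteq> {0}"
      and bound: "\<forall>n\<ge>2. \<forall>x :: nat \<Rightarrow> 'h.
        (\<Sum>i=1..n. ip_norm ip (x i))\<^sup>2
          \<le> (ip_norm ip (\<Sum>i=1..n. x i))\<^sup>2
            + E * (\<Sum>(i, j) \<in> {(i, j). 1 \<le> i \<and> i < j \<and> j \<le> n}.
                (real j - real i) powr (2 / q)
                * (\<Sum>k=1..n-1. ip_norm ip (fdiff x k) powr p) powr (2 / p))" for E
  proof -
    obtain e :: 'h where "e \<noteq> 0"
      using nontrivial by auto
    then show ?thesis
      by (rule opposite_pair_constant_ge_1[OF assms(2)]) (rule bound[rule_format, OF order_refl])
  qed
  show ?thesis
    using upper sharp by blast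
qed

end
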